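(* The exponential family $\{\mathcal{P}_{A,\Theta}\}_{A\in\mathcal{A}}$ is projective if and only if the sufficient statistics $\{T_A\}_{A\in\mathcal{A}}$ have separable increments.
   Context: Let $\mathbb{I}$ be a denumerable set and $\mathcal{A}$ a collection of finite subsets of $\mathbb{I}$, partially ordered by inclusion, which is an ideal: subsets of members of $\mathcal{A}$ and unions of two members of $\mathcal{A}$ belong to $\mathcal{A}$. To each $A\in\mathcal{A}$ is attached a countable set $\mathcal{X}_A$, in such a way that for $A\subset B$ in $\mathcal{A}$ one has $\mathcal{X}_B=\mathcal{X}_A\times\mathcal{X}_{B\setminus A}$; points of $\mathcal{X}_B$ are written $(x,y)$ with $x\in\mathcal{X}_A$, $y\in\mathcal{X}_{B\setminus A}$, and $\pi_{B\mapsto A}:\mathcal{X}_B\to\mathcal{X}_A$, $\pi_{B\mapsto A}(x,y)=x$, is the coordinate projection. Let $\Theta\subseteq\mathbb{R}^d$ be a fixed open set. For each $A\in\mathcal{A}$ let $t_A:\mathcal{X}_A\to\mathbb{R}^d$ be a function (the minimal sufficient statistic) such that $z_A(\theta)=\sum_{x\in\mathcal{X}_A}e^{\langle\theta,t_A(x)\rangle}$ is finite for every $\theta\in\Theta$, and let $\mathbb{P}_{A,\theta}$ be the probability distribution on $\mathcal{X}_A$ with mass function $p_{A,\theta}(x)=e^{\langle\theta,t_A(x)\rangle}/z_A(\theta)$. Put $\mathcal{P}_{A,\Theta}=\{\mathbb{P}_{A,\theta}\}_{\theta\in\Theta}$, and let $T_A=t_A(X_A)$ where $X_A\sim\mathbb{P}_{A,\theta}$.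 The family $\{\mathcal{P}_{A,\Theta}\}_{A\in\mathcal{A}}$ is projective if for all $A\subset B$ in $\mathcal{A}$ and all $\theta\in\Theta$, $\mathbb{P}_{A,\theta}=\mathbb{P}_{B,\theta}\circ\pi_{B\mapsto A}^{-1}$. For $A\subset B$ in $\mathcal{A}$ let $t_{B\setminus A}(x,y)=t_B(x,y)-t_A(x)$ denote the increment of the sufficient statistic (in this statement this notation does not mean the sufficient statistic attached to the index set $B\setminus A$), and define the conditional volume factor $v_{B\setminus A|A}(\delta,x)=|\{y\in\mathcal{X}_{B\setminus A}: t_{B\setminus A}(x,y)=\delta\}|$. The sufficient statistics have separable increments if, for each $A\subset B$ in $\mathcal{A}$, the range of possible increments $\{t_{B\setminus A}(x,y):y\in\mathcal{X}_{B\setminus A}\}$ is the same for all $x\in\mathcal{X}_A$, and the conditional volume factor is constant in $x$, i.e. $v_{B\setminus A|A}(\delta,x)=v_{B\setminus A}(\delta)$ for all $x\in\mathcal{X}_A$ and all $\delta$. *)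

theory Defs
  imports "HOL-Probability.Probability"
begin

text \<open>
  The sample space attached to a finite index set \<open>A\<close> is \<open>X A\<close>.  All sample spaces
  live in one ambient type, so the identification of \<open>X B\<close> with \<open>X A \<times> X (B - A)\<close> is made
  explicit: \<open>pair A B (x, y)\<close> is the point of \<open>X B\<close> with coordinates \<open>x\<close> in \<open>X A\<close> and \<open>y\<close> in
  \<open>X (B - A)\<close>, and \<open>pair A B\<close> is a bijection from the product onto \<open>X B\<close>.
\<close>

definition ideal_of_finite_sets :: "'i set \<Rightarrow> 'i set set \<Rightarrow> bool" where
  "ideal_of_finite_sets I \<A> \<longleftrightarrow>
     (\<forall>A\<in>\<A>. finite A \<and> A \<subseteq> I) \<and>
     (\<forall>A\<in>\<A>. \<forall>C. C \<subseteq> A \<longrightarrow> C \<in> \<A>) \<and>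
     (\<forall>A\<in>\<A>. \<forall>B\<in>\<A>. A \<union> B \<in> \<A>)"

definition product_spaces ::
  "'i set set \<Rightarrow> ('i set \<Rightarrow> 'x set) \<Rightarrow> ('i set \<Rightarrow> 'i set \<Rightarrow> 'x \<times> 'x \<Rightarrow> 'x) \<Rightarrow> bool" where
  "product_spaces \<A> X pair \<longleftrightarrow>
     (\<forall>A\<in>\<A>. \<forall>B\<in>\<A>. A \<subset> B \<longrightarrow> bij_betw (pair A B) (X A \<times> X (B - A)) (X B))"

definition coord_proj ::
  "('i set \<Rightarrow> 'x set) \<Rightarrow> ('i set \<Rightarrow> 'i set \<Rightarrow> 'x \<times> 'x \<Rightarrow> 'x) \<Rightarrow> 'i set \<Rightarrow> 'i set \<Rightarrow> 'x \<Rightarrow> 'x" where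
  "coord_proj X pair B A z = fst (inv_into (X A \<times> X (B - A)) (pair A B) z)"

lemma coord_proj_pair:
  assumes "product_spaces \<A> X pair" "A \<in> \<A>" "B \<in> \<A>" "A \<subset> B" "x \<in> X A" "y \<in> X (B - A)"
  shows "coord_proj X pair B A (pair A B (x, y)) = x"
proof -
  have "inj_on (pair A B) (X A \<times> X (B - A))"
    using assms by (auto simp: product_spaces_def bij_betw_def)
  then show ?thesis
    using assms by (simp add: coord_proj_def inv_into_f_f)
qed

definition partition_fun ::
  "('i set \<Rightarrow> 'x set) \<Rightarrow> ('i set \<Rightarrow> 'x \<Rightarrow> real ^ 'd) \<Rightarrow> 'i set \<Rightarrow> real ^ 'd \<Rightarrow> real" where
  "partition_fun X t A \<theta> = (\<Sum>\<^sub>\<infinity>x\<in>X A. exp (\<theta> \<bullet> t A x))"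

definition expfam_mass ::
  "('i set \<Rightarrow> 'x set) \<Rightarrow> ('i set \<Rightarrow> 'x \<Rightarrow> real ^ 'd) \<Rightarrow> 'i set \<Rightarrow> real ^ 'd \<Rightarrow> 'x \<Rightarrow> real" where
  "expfam_mass X t A \<theta> x = exp (\<theta> \<bullet> t A x) / partition_fun X t A \<theta>"

definition expfam_distr ::
  "('i set \<Rightarrow> 'x set) \<Rightarrow> ('i set \<Rightarrow> 'x \<Rightarrow> real ^ 'd) \<Rightarrow> 'i set \<Rightarrow> real ^ 'd \<Rightarrow> 'x measure" where
  "expfam_distr X t A \<theta> = point_measure (X A) (\<lambda>x. ennreal (expfam_mass X t A \<theta> x))"

definition projective_exp_family ::
  "'i set set \<Rightarrow> ('i set \<Rightarrow> 'x set) \<Rightarrow> ('i set \<Rightarrow> 'i set \<Rightarrow> 'x \<times> 'x \<Rightarrow> 'x)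
     \<Rightarrow> (real ^ 'd) set \<Rightarrow> ('i set \<Rightarrow> 'x \<Rightarrow> real ^ 'd) \<Rightarrow> bool" where
  "projective_exp_family \<A> X pair \<Theta> t \<longleftrightarrow>
     (\<forall>A\<in>\<A>. \<forall>B\<in>\<A>. A \<subset> B \<longrightarrow> (\<forall>\<theta>\<in>\<Theta>.
        expfam_distr X t A \<theta> =
          distr (expfam_distr X t B \<theta>) (count_space (X A)) (coord_proj X pair B A)))"

definition increment ::
  "('i set \<Rightarrow> 'i set \<Rightarrow> 'x \<times> 'x \<Rightarrow> 'x) \<Rightarrow> ('i set \<Rightarrow> 'x \<Rightarrow> real ^ 'd)
     \<Rightarrow> 'i set \<Rightarrow> 'i set \<Rightarrow> 'x \<Rightarrow> 'x \<Rightarrow> real ^ 'd" where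
  "increment pair t A B x y = t B (pair A B (x, y)) - t A x"

text \<open>
  The cardinality below is that of a finite set whenever the partition function of \<open>B\<close> converges
  at some \<open>\<theta>\<close>, because \<open>exp (\<theta> \<bullet> t B z)\<close> takes the same positive value at all the points
  \<open>z = pair A B (x, y)\<close> that are counted.  Hence the convention that \<open>card\<close> is 0 on infinite
  sets is immaterial.
\<close>

definition cond_volume ::
  "('i set \<Rightarrow> 'x set) \<Rightarrow> ('i set \<Rightarrow> 'i set \<Rightarrow> 'x \<times> 'x \<Rightarrow> 'x) \<Rightarrow> ('i set \<Rightarrow> 'x \<Rightarrow> real ^ 'd)
     \<Rightarrow> 'i set \<Rightarrow> 'i set \<Rightarrow> real ^ 'd \<Rightarrow> 'x \<Rightarrow> nat" where
  "cond_volume X pair t A B \<delta> x = card {y \<in> X (B - A). increment pair t A B x y = \<delta>}"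

definition separable_increments ::
  "'i set set \<Rightarrow> ('i set \<Rightarrow> 'x set) \<Rightarrow> ('i set \<Rightarrow> 'i set \<Rightarrow> 'x \<times> 'x \<Rightarrow> 'x)
     \<Rightarrow> ('i set \<Rightarrow> 'x \<Rightarrow> real ^ 'd) \<Rightarrow> bool" where
  "separable_increments \<A> X pair t \<longleftrightarrow>
     (\<forall>A\<in>\<A>. \<forall>B\<in>\<A>. A \<subset> B \<longrightarrow>
        (\<forall>x\<in>X A. \<forall>x'\<in>X A.
           increment pair t A B x ` X (B - A) = increment pair t A B x' ` X (B - A)) \<and>
        (\<exists>v. \<forall>x\<in>X A. \<forall>\<delta>. cond_volume X pair t A B \<delta> x = v \<delta>))"

lemma prob_space_expfam_distr:
  assumes "X A \<noteq> {}" "(\<lambda>x. exp (\<theta> \<bullet> t A x)) summable_on X A"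
  shows "prob_space (expfam_distr X t A \<theta>)"
proof
  let ?e = "\<lambda>x. exp (\<theta> \<bullet> t A x)" and ?z = "partition_fun X t A \<theta>"
  obtain a where a: "a \<in> X A" using assms(1) by blast
  have "sum ?e {a} \<le> (\<Sum>\<^sub>\<infinity>x\<in>X A. ?e x)"
    using assms(2) a by (intro finite_sum_le_infsum) auto
  then have z: "?z > 0"
    unfolding partition_fun_def by (rule less_le_trans[rotated]) simp
  have summ: "expfam_mass X t A \<theta> summable_on X A"
    using assms(2) unfolding expfam_mass_def divide_inverse by (rule summable_on_cmult_left)
  have nonneg: "expfam_mass X t A \<theta> x \<ge> 0" for x
    using z by (simp add: expfam_mass_def)
  have abs: "Infinite_Set_Sum.abs_summable_on (expfam_mass X t A \<theta>) (X A)"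
    using summ nonneg by (simp flip: abs_summable_equivalent)
  have "emeasure (expfam_distr X t A \<theta>) (space (expfam_distr X t A \<theta>))
      = (\<integral>\<^sup>+x. ennreal (expfam_mass X t A \<theta> x) \<partial>count_space (X A))"
    by (simp add: expfam_distr_def space_point_measure point_measure_def emeasure_density
        cong: nn_integral_cong_simp)
  also have "\<dots> = ennreal (\<Sum>\<^sub>\<infinity>x\<in>X A. expfam_mass X t A \<theta> x)"
    using abs nonneg by (simp add: nn_integral_conv_infsetsum infsetsum_infsum)
  also have "\<dots> = 1"
    using z by (simp add: expfam_mass_def divide_inverse infsum_cmult_left' flip: partition_fun_def)
  finally show "emeasure (expfam_distr X t A \<theta>) (space (expfam_distr X t A \<theta>)) = 1" .
qed

end

theory Submission
  imports Defs "HOL-Complex_Analysis.Complex_Analysis"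
begin

text \<open>
  Fix \<open>A \<subset> B\<close> and write \<open>L \<theta> x\<close> for the sum of \<open>exp (\<theta> \<bullet> increment pair t A B x y)\<close> over \<open>y\<close>.  Since
  \<open>exp (\<theta> \<bullet> t B (x, y))\<close> factors as \<open>exp (\<theta> \<bullet> t A x)\<close> times the exponential of the increment, the
  mass that the \<open>B\<close>-distribution gives to the fibre over \<open>x\<close> is proportional to
  \<open>exp (\<theta> \<bullet> t A x) * L \<theta> x\<close>.  This agrees with the mass function of the \<open>A\<close>-distribution precisely
  when \<open>L \<theta> x\<close> is the same for all \<open>x\<close>; the value of the constant is then forced, both families
  being normalised.  So projectivity says that \<open>L \<theta>\<close> is constant on \<open>X A\<close> for every \<open>\<theta> \<in> \<Theta>\<close>
  (\<open>distr_eq_iff_marginal_masses\<close>, \<open>marginal_masses_iff_constant_increment_sum\<close>).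

  Now \<open>L \<theta> x\<close> is the Laplace transform, at \<open>\<theta>\<close>, of the measure on increments that counts how
  many \<open>y\<close> realise each value, and this measure is what the conditional volume factors record.
  Equal volume factors at \<open>x\<close> and \<open>x'\<close> give a permutation of \<open>X (B - A)\<close> that carries the increments
  at \<open>x\<close> to those at \<open>x'\<close> (\<open>bij_betw_of_equal_multiplicities\<close>), and hence equal Laplace transforms.

  The converse is uniqueness of Laplace transforms that are finite on an open set, for counting
  measures with countably many atoms (\<open>exponential_sums_determine_multiplicities\<close>).  The atoms may
  be dense, so no dominant term can be peeled off.  Moving from a point of \<open>\<Theta>\<close> along a direction
  \<open>u\<close> for which \<open>p \<mapsto> u \<bullet> p\<close> isolates the atom of interest from the others reduces to one
  dimension.  There the two transforms extend holomorphically to a vertical strip; they agree on a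
  real interval, so also on the imaginary axis, where they are characteristic functions of
  discrete distributions, and Levy's uniqueness theorem applies.
\<close>

section \<open>Discrete measures with a given mass function\<close>

lemma emeasure_point_measure_infsum:
  assumes "S \<subseteq> Y" and "w summable_on Y" and nn: "\<And>y. y \<in> Y \<Longrightarrow> w y \<ge> (0::real)"
  shows "emeasure (point_measure Y (\<lambda>y. ennreal (w y))) S = ennreal (\<Sum>\<^sub>\<infinity>y\<in>S. w y)"
proof -
  have summ: "w summable_on S"
    using assms(1,2) summable_on_subset_banach by blast
  have "(\<lambda>y. norm (w y)) summable_on S"
    using summ nn assms(1) by (subst summable_on_cong[of _ _ w]) auto
  then have abs: "Infinite_Set_Sum.abs_summable_on w S"
    by (simp flip: abs_summable_equivalent)
  have "emeasure (point_measure Y (\<lambda>y. ennreal (w y))) S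
      = (\<integral>\<^sup>+y. ennreal (w y) * indicator S y \<partial>count_space Y)"
    using assms(1) by (simp add: point_measure_def emeasure_density)
  also have "\<dots> = (\<integral>\<^sup>+y. ennreal (w y) \<partial>count_space S)"
    using assms(1) by (subst nn_integral_count_space_indicator[of Y])
      (auto simp: nn_integral_count_space_indicator mult.assoc intro!: nn_integral_cong
            split: split_indicator)
  also have "\<dots> = ennreal (\<Sum>\<^sub>\<infinity>y\<in>S. w y)"
    using abs nn assms(1) by (subst nn_integral_conv_infsetsum) (auto simp: infsetsum_infsum)
  finally show ?thesis .
qed

lemma integral_point_measure_infsum:
  fixes g :: "'a \<Rightarrow> complex"
  assumes nn: "\<And>y. y \<in> Y \<Longrightarrow> w y \<ge> (0::real)"
    and "(\<lambda>y. norm (of_real (w y) * g y)) summable_on Y"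
  shows "integral\<^sup>L (point_measure Y (\<lambda>y. ennreal (w y))) g = (\<Sum>\<^sub>\<infinity>y\<in>Y. of_real (w y) * g y)"
proof -
  have "integral\<^sup>L (point_measure Y (\<lambda>y. ennreal (w y))) g
      = integral\<^sup>L (count_space Y) (\<lambda>y. w y *\<^sub>R g y)"
    unfolding point_measure_def using nn
    by (subst integral_density) (auto simp: AE_count_space)
  also have "\<dots> = infsetsum (\<lambda>y. of_real (w y) * g y) Y"
    by (simp add: infsetsum_def scaleR_conv_of_real)
  also have "\<dots> = (\<Sum>\<^sub>\<infinity>y\<in>Y. of_real (w y) * g y)"
    by (rule infsetsum_infsum) (use assms(2) abs_summable_equivalent in blast)
  finally show ?thesis .
qed

section \<open>Uniqueness for exponential sums on the real line\<close>

text \<open>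
  The bound depends on \<open>z\<close> only through the half-width \<open>r\<close> of the strip, so that the values at the two
  real points \<open>r\<close> and \<open>-r\<close> control the sum on the whole strip in the Weierstrass M-test.
\<close>

lemma exponential_sum_dominated:
  fixes w a :: "'a \<Rightarrow> real"
  assumes "w y \<ge> 0" and "\<bar>Re z\<bar> \<le> r"
  shows "norm (of_real (w y) * exp (z * of_real (a y)))
           \<le> w y * exp (r * a y) + w y * exp (- r * a y)"
proof -
  have "Re z * a y \<le> \<bar>Re z\<bar> * \<bar>a y\<bar>"
    by (metis abs_ge_self abs_mult)
  also have "\<dots> \<le> r * \<bar>a y\<bar>"
    using assms(2) by (intro mult_right_mono) auto
  finally have "exp (Re z * a y) \<le> exp (r * \<bar>a y\<bar>)" by simp
  also have "\<dots> \<le> exp (r * a y) + exp (- r * a y)"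
    by (cases "a y \<ge> 0") (auto simp: add_increasing add_increasing2)
  finally have "w y * exp (Re z * a y) \<le> w y * (exp (r * a y) + exp (- r * a y))"
    using assms(1) by (rule mult_left_mono)
  then show ?thesis
    using assms(1) by (simp add: norm_mult algebra_simps)
qed

text \<open>
  The finite partial sums are entire and converge uniformly on the strip, because two real points
  already dominate them.
\<close>

lemma exponential_sum_holomorphic:
  fixes w a :: "'a \<Rightarrow> real"
  assumes nn: "\<And>y. y \<in> Y \<Longrightarrow> w y \<ge> 0"
    and summ: "(\<lambda>y. w y * exp (r * a y)) summable_on Y" "(\<lambda>y. w y * exp (- r * a y)) summable_on Y"
  shows "(\<lambda>z. \<Sum>\<^sub>\<infinity>y\<in>Y. of_real (w y) * exp (z * of_real (a y)))
           holomorphic_on {z. -r < Re z \<and> Re z < r}"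
proof -
  let ?f = "\<lambda>z. \<Sum>\<^sub>\<infinity>y\<in>Y. of_real (w y) * exp (z * of_real (a y))"
  let ?F = "\<lambda>F z. \<Sum>y\<in>F. of_real (w y) * exp (z * of_real (a y))"
  let ?S = "{z. -r < Re z \<and> Re z < r}"
  have "?S = {z. -r < Re z} \<inter> {z. Re z < r}" by auto
  then have "open ?S" by (simp add: open_Int open_halfspace_Re_gt open_halfspace_Re_lt)
  moreover have "?f field_differentiable at z" if "z \<in> ?S" for z
  proof -
    have "\<exists>e>0. cball z e \<subseteq> ?S"
      by (rule iffD1[OF spec[OF open_contains_cball_eq[OF \<open>open ?S\<close>]] that])
    then obtain e where e: "e > 0" "cball z e \<subseteq> ?S" by (elim exE conjE)
    have strip: "\<bar>Re z'\<bar> \<le> r" if "z' \<in> cball z e" for z'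
      using subsetD[OF e(2) that] by auto
    have "uniform_limit (cball z e) ?F ?f (finite_subsets_at_top Y)"
      by (rule Weierstrass_m_test_general[OF _ summable_on_add[OF summ]])
         (rule exponential_sum_dominated, erule nn, erule strip)
    moreover have "\<forall>\<^sub>F F in finite_subsets_at_top Y.
        continuous_on (cball z e) (?F F) \<and> ?F F holomorphic_on ball z e"
      by (intro always_eventually allI conjI continuous_intros holomorphic_intros)
    ultimately have "?f holomorphic_on ball z e"
      using holomorphic_uniform_limit[of z e ?F "finite_subsets_at_top Y" ?f]
        finite_subsets_at_top_neq_bot by blast
    then show ?thesis
      using e(1) by (simp add: holomorphic_on_imp_differentiable_at)
  qed
  ultimately show ?thesis
    by (simp add: holomorphic_on_def field_differentiable_at_within)
qed

text \<open>
  Analytic continuation from the real segment of the strip to the imaginary axis.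
\<close>

lemma exponential_sums_determine_char_sums:
  fixes a w :: "'a \<Rightarrow> real" and b v :: "'b \<Rightarrow> real"
  assumes "r > 0"
    and w: "\<And>y. y \<in> Y \<Longrightarrow> w y \<ge> 0" and v: "\<And>y. y \<in> Y' \<Longrightarrow> v y \<ge> 0"
    and summ: "\<And>s. \<bar>s\<bar> \<le> r \<Longrightarrow> (\<lambda>y. w y * exp (s * a y)) summable_on Y"
              "\<And>s. \<bar>s\<bar> \<le> r \<Longrightarrow> (\<lambda>y. v y * exp (s * b y)) summable_on Y'"
    and eq: "\<And>s. \<bar>s\<bar> \<le> r \<Longrightarrow>
               (\<Sum>\<^sub>\<infinity>y\<in>Y. w y * exp (s * a y)) = (\<Sum>\<^sub>\<infinity>y\<in>Y'. v y * exp (s * b y))"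
  shows "(\<Sum>\<^sub>\<infinity>y\<in>Y. of_real (w y) * iexp (\<tau> * a y)) = (\<Sum>\<^sub>\<infinity>y\<in>Y'. of_real (v y) * iexp (\<tau> * b y))"
proof -
  define f where "f z = (\<Sum>\<^sub>\<infinity>y\<in>Y. of_real (w y) * exp (z * of_real (a y)))" for z :: complex
  define g where "g z = (\<Sum>\<^sub>\<infinity>y\<in>Y'. of_real (v y) * exp (z * of_real (b y)))" for z :: complex
  let ?S = "{z. -r < Re z \<and> Re z < r}"
  have S: "?S = {z. -r < Re z} \<inter> {z. Re z < r}" by auto
  have "f (\<i> * \<tau>) - g (\<i> * \<tau>) = 0"
  proof (rule analytic_continuation[where f = "\<lambda>z. f z - g z" and S = ?S
        and U = "of_real ` {-r<..<r}" and \<xi> = 0])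
    show "(\<lambda>z. f z - g z) holomorphic_on ?S"
      unfolding f_def g_def using assms(1)
      by (intro holomorphic_on_diff exponential_sum_holomorphic w v)
         (use summ[of r] summ[of "-r"] in auto)
    show "open ?S" unfolding S
      by (simp add: open_Int open_halfspace_Re_gt open_halfspace_Re_lt)
    show "connected ?S" unfolding S
      by (intro convex_connected convex_Int convex_halfspace_Re_gt convex_halfspace_Re_lt)
    have "(0::real) islimpt {-r<..<r}"
      using assms(1) by (intro interior_limit_point) (simp add: interior_open)
    then show "(0::complex) islimpt of_real ` {-r<..<r}"
      using islimpt_isCont_image[of 0 _ "of_real :: real \<Rightarrow> complex"]
      by (simp add: eventually_at_filter)
    fix z assume "z \<in> (of_real ` {-r<..<r} :: complex set)"
    then obtain s where s: "z = of_real s" "\<bar>s\<bar> \<le> r" by auto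
    have "f z = of_real (\<Sum>\<^sub>\<infinity>y\<in>Y. w y * exp (s * a y))"
      using has_sum_infsum[OF summ(1)[OF s(2)]] unfolding f_def s(1)
      by (intro infsumI) (simp flip: has_sum_of_real_iff[where 'a=complex] exp_of_real)
    moreover have "g z = of_real (\<Sum>\<^sub>\<infinity>y\<in>Y'. v y * exp (s * b y))"
      using has_sum_infsum[OF summ(2)[OF s(2)]] unfolding g_def s(1)
      by (intro infsumI) (simp flip: has_sum_of_real_iff[where 'a=complex] exp_of_real)
    ultimately show "f z - g z = 0"
      using eq[OF s(2)] by simp
  qed (use assms(1) in auto)
  then show ?thesis
    by (simp add: f_def g_def mult.assoc)
qed

text \<open>
  The image of a discrete distribution \<open>w\<close> under \<open>a\<close>; several points of \<open>Y\<close> may have the same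
  image, so an atom collects the weight of a whole fibre of \<open>a\<close>.
\<close>

lemma
  fixes a w :: "'a \<Rightarrow> real"
  assumes w: "\<And>y. y \<in> Y \<Longrightarrow> w y \<ge> 0" and summ: "w summable_on Y"
    and one: "(\<Sum>\<^sub>\<infinity>y\<in>Y. w y) = 1"
  defines "M \<equiv> distr (point_measure Y (\<lambda>y. ennreal (w y))) borel a"
  shows real_distribution_atoms: "real_distribution M"
    and char_atoms: "char M \<tau> = (\<Sum>\<^sub>\<infinity>y\<in>Y. of_real (w y) * iexp (\<tau> * a y))"
    and emeasure_atoms: "emeasure M {c} = ennreal (\<Sum>\<^sub>\<infinity>y\<in>{y\<in>Y. a y = c}. w y)"
proof -
  let ?P = "point_measure Y (\<lambda>y. ennreal (w y))"
  have [measurable]: "a \<in> measurable ?P borel"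
    by (simp add: point_measure_def)
  have "prob_space ?P"
    by standard (use w summ one in \<open>simp add: space_point_measure emeasure_point_measure_infsum\<close>)
  then show "real_distribution M"
    unfolding M_def real_distribution_def real_distribution_axioms_def
    by (auto intro: prob_space.prob_space_distr)
  have "(\<lambda>y. norm (of_real (w y) * iexp (\<tau> * a y))) summable_on Y"
    using summ w by (subst summable_on_cong[of _ _ w]) (auto simp: norm_mult)
  with w show "char M \<tau> = (\<Sum>\<^sub>\<infinity>y\<in>Y. of_real (w y) * iexp (\<tau> * a y))"
    unfolding M_def char_def
    by (subst integral_distr) (auto simp: integral_point_measure_infsum)
  have "emeasure M {c} = emeasure ?P {y\<in>Y. a y = c}"
    unfolding M_def by (subst emeasure_distr)
      (auto simp: space_point_measure intro!: arg_cong2[where f = emeasure])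
  also have "\<dots> = ennreal (\<Sum>\<^sub>\<infinity>y\<in>{y\<in>Y. a y = c}. w y)"
    using w summ by (intro emeasure_point_measure_infsum) auto
  finally show "emeasure M {c} = ennreal (\<Sum>\<^sub>\<infinity>y\<in>{y\<in>Y. a y = c}. w y)" .
qed

text \<open>
  The equation at \<open>s = 0\<close> says that the total weights agree.  If the total is zero, all weights
  vanish; otherwise both sides may be divided by it.  The resulting probability distributions on the line have the same characteristic
  function, hence are equal, and so are their atoms at \<open>c\<close>.
\<close>

lemma exponential_sums_determine_atoms:
  fixes a w :: "'a \<Rightarrow> real" and b v :: "'b \<Rightarrow> real"
  assumes "r > 0"
    and w: "\<And>y. y \<in> Y \<Longrightarrow> w y \<ge> 0" and v: "\<And>y. y \<in> Y' \<Longrightarrow> v y \<ge> 0"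
    and summ: "\<And>s. \<bar>s\<bar> \<le> r \<Longrightarrow> (\<lambda>y. w y * exp (s * a y)) summable_on Y"
              "\<And>s. \<bar>s\<bar> \<le> r \<Longrightarrow> (\<lambda>y. v y * exp (s * b y)) summable_on Y'"
    and eq: "\<And>s. \<bar>s\<bar> \<le> r \<Longrightarrow>
               (\<Sum>\<^sub>\<infinity>y\<in>Y. w y * exp (s * a y)) = (\<Sum>\<^sub>\<infinity>y\<in>Y'. v y * exp (s * b y))"
  shows "(\<Sum>\<^sub>\<infinity>y\<in>{y\<in>Y. a y = c}. w y) = (\<Sum>\<^sub>\<infinity>y\<in>{y\<in>Y'. b y = c}. v y)"
proof -
  define Z where "Z = (\<Sum>\<^sub>\<infinity>y\<in>Y. w y)"
  have Z': "Z = (\<Sum>\<^sub>\<infinity>y\<in>Y'. v y)" using eq[of 0] assms(1) by (simp add: Z_def)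
  have sw: "w summable_on Y" and sv: "v summable_on Y'"
    using summ[of 0] assms(1) by simp_all
  have "Z \<ge> 0" unfolding Z_def using w by (rule infsum_nonneg)
  show ?thesis
  proof (cases "Z = 0")
    case True
    have "w y = 0" if "y \<in> Y" for y
      using nonneg_infsum_le_0D[OF _ sw w that] True by (simp add: Z_def)
    moreover have "v y = 0" if "y \<in> Y'" for y
      using nonneg_infsum_le_0D[OF _ sv v that] True by (simp add: Z')
    ultimately have "(\<Sum>\<^sub>\<infinity>y\<in>{y\<in>Y. a y = c}. w y) = 0"
        "(\<Sum>\<^sub>\<infinity>y\<in>{y\<in>Y'. b y = c}. v y) = 0"
      by (auto intro!: infsum_0)
    then show ?thesis by simp
  next
    case False
    with \<open>Z \<ge> 0\<close> have "Z > 0" by simp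
    define p where "p y = w y / Z" for y
    define q where "q y = v y / Z" for y
    have p: "\<And>y. y \<in> Y \<Longrightarrow> p y \<ge> 0" and q: "\<And>y. y \<in> Y' \<Longrightarrow> q y \<ge> 0"
      using w v \<open>Z > 0\<close> by (simp_all add: p_def q_def)
    have sp: "p summable_on Y" "q summable_on Y'"
      unfolding p_def q_def divide_inverse by (intro summable_on_cmult_left sw sv)+
    have sum_p: "(\<Sum>\<^sub>\<infinity>y\<in>S. p y) = (\<Sum>\<^sub>\<infinity>y\<in>S. w y) / Z" for S
      unfolding p_def divide_inverse by (rule infsum_cmult_left')
    have sum_q: "(\<Sum>\<^sub>\<infinity>y\<in>S. q y) = (\<Sum>\<^sub>\<infinity>y\<in>S. v y) / Z" for S
      unfolding q_def divide_inverse by (rule infsum_cmult_left')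
    have one: "(\<Sum>\<^sub>\<infinity>y\<in>Y. p y) = 1" "(\<Sum>\<^sub>\<infinity>y\<in>Y'. q y) = 1"
      using False by (simp_all add: sum_p sum_q flip: Z_def Z')
    let ?M = "distr (point_measure Y (\<lambda>y. ennreal (p y))) borel a"
    let ?N = "distr (point_measure Y' (\<lambda>y. ennreal (q y))) borel b"
    have "char ?M \<tau> = char ?N \<tau>" for \<tau>
    proof -
      have "char ?M \<tau> = (\<Sum>\<^sub>\<infinity>y\<in>Y. of_real (w y) * iexp (\<tau> * a y)) / Z"
        unfolding divide_inverse infsum_cmult_left'[symmetric]
        by (subst char_atoms) (auto simp: p sp one, auto simp: p_def divide_inverse intro!: infsum_cong)
      moreover have "char ?N \<tau> = (\<Sum>\<^sub>\<infinity>y\<in>Y'. of_real (v y) * iexp (\<tau> * b y)) / Z"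
        unfolding divide_inverse infsum_cmult_left'[symmetric]
        by (subst char_atoms) (auto simp: q sp one, auto simp: q_def divide_inverse intro!: infsum_cong)
      ultimately show ?thesis
        using exponential_sums_determine_char_sums[OF assms(1) w v summ eq] by simp
    qed
    then have "?M = ?N"
      by (intro Levy_uniqueness real_distribution_atoms p q sp one ext)
    then have "ennreal (\<Sum>\<^sub>\<infinity>y\<in>{y\<in>Y. a y = c}. p y) = ennreal (\<Sum>\<^sub>\<infinity>y\<in>{y\<in>Y'. b y = c}. q y)"
      using emeasure_atoms[OF p sp(1) one(1), of a c] emeasure_atoms[OF q sp(2) one(2), of b c]
      by simp
    then have "(\<Sum>\<^sub>\<infinity>y\<in>{y\<in>Y. a y = c}. p y) = (\<Sum>\<^sub>\<infinity>y\<in>{y\<in>Y'. b y = c}. q y)"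
      using p q by (subst (asm) ennreal_inj) (auto intro!: infsum_nonneg)
    then show ?thesis
      using False by (simp add: sum_p sum_q)
  qed
qed

section \<open>Uniqueness for exponential sums in several dimensions\<close>

text \<open>
  Countably many hyperplanes form a null set, so they do not cover the space.
\<close>

lemma exists_direction_avoiding_hyperplanes:
  fixes C :: "'v::euclidean_space set"
  assumes "countable C"
  obtains u where "\<And>c. c \<in> C \<Longrightarrow> c \<noteq> 0 \<Longrightarrow> u \<bullet> c \<noteq> 0"
proof -
  have "negligible (\<Union>c\<in>C - {0}. {u. c \<bullet> u = 0})"
    using assms by (intro negligible_countable_Union) (auto intro: negligible_hyperplane)
  then obtain u where "u \<notin> (\<Union>c\<in>C - {0}. {u. c \<bullet> u = 0})"
    by (metis UNIV_eq_I non_negligible_UNIV)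
  then show thesis
    by (intro that[of u]) (auto simp: inner_commute)
qed

text \<open>
  All points of a fibre contribute the same positive term to a convergent series.
\<close>

lemma finite_fibre:
  fixes f :: "'a \<Rightarrow> 'v::real_inner"
  assumes "(\<lambda>y. exp (\<theta> \<bullet> f y)) summable_on Y"
  shows "finite {y\<in>Y. f y = d}"
proof -
  have "(\<lambda>y. exp (\<theta> \<bullet> f y)) summable_on {y\<in>Y. f y = d}"
    using assms by (rule summable_on_subset_banach) auto
  then have "(\<lambda>y. exp (\<theta> \<bullet> d)) summable_on {y\<in>Y. f y = d}"
    by (subst (asm) summable_on_cong[of _ _ "\<lambda>y. exp (\<theta> \<bullet> d)"]) auto
  then show ?thesis
    using infsum_diverge_constant[of _ "exp (\<theta> \<bullet> d)"] by auto
qed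

text \<open>
  On the line through \<open>\<theta> \<in> \<Theta>\<close> with direction \<open>u\<close> both sums become one-dimensional exponential sums
  with weights \<open>exp (\<theta> \<bullet> f y)\<close> and \<open>exp (\<theta> \<bullet> g y)\<close>.  If \<open>u\<close> is orthogonal to no nonzero difference
  \<open>p - d\<close> with \<open>p\<close> in one of the two ranges, then \<open>d\<close> is the only point of these ranges that projects
  to \<open>u \<bullet> d\<close>.  The atoms at \<open>u \<bullet> d\<close> therefore weigh \<open>exp (\<theta> \<bullet> d)\<close> times the multiplicities of \<open>d\<close>.
\<close>

lemma exponential_sums_determine_multiplicities:
  fixes f :: "'a \<Rightarrow> 'v::euclidean_space" and g :: "'b \<Rightarrow> 'v"
  assumes "countable Y" "countable Y'" "open \<Theta>" "\<Theta> \<noteq> {}"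
    and summ: "\<And>\<theta>. \<theta> \<in> \<Theta> \<Longrightarrow> (\<lambda>y. exp (\<theta> \<bullet> f y)) summable_on Y"
              "\<And>\<theta>. \<theta> \<in> \<Theta> \<Longrightarrow> (\<lambda>y. exp (\<theta> \<bullet> g y)) summable_on Y'"
    and eq: "\<And>\<theta>. \<theta> \<in> \<Theta> \<Longrightarrow> (\<Sum>\<^sub>\<infinity>y\<in>Y. exp (\<theta> \<bullet> f y)) = (\<Sum>\<^sub>\<infinity>y\<in>Y'. exp (\<theta> \<bullet> g y))"
  shows "card {y\<in>Y. f y = d} = card {y\<in>Y'. g y = d}"
proof -
  obtain \<theta> where \<theta>: "\<theta> \<in> \<Theta>" using assms(4) by blast
  obtain e where e: "e > 0" "cball \<theta> e \<subseteq> \<Theta>"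
    using assms(3) \<theta> open_contains_cball_eq by blast
  have "countable ((\<lambda>p. p - d) ` (f ` Y \<union> g ` Y'))"
    using assms(1,2) by simp
  then obtain u where
    u: "\<And>c. c \<in> (\<lambda>p. p - d) ` (f ` Y \<union> g ` Y') \<Longrightarrow> c \<noteq> 0 \<Longrightarrow> u \<bullet> c \<noteq> 0"
    using exists_direction_avoiding_hyperplanes by metis
  \<comment> \<open>The summand 1 keeps the quotient meaningful when \<open>u = 0\<close>.\<close>
  define r where "r = e / (norm u + 1)"
  have pos: "norm u + 1 > 0" by (simp add: add_nonneg_pos)
  then have "r > 0" using e by (simp add: r_def)
  have mem: "\<theta> + s *\<^sub>R u \<in> \<Theta>" if "\<bar>s\<bar> \<le> r" for s
  proof -
    have "\<bar>s\<bar> * norm u \<le> r * (norm u + 1)"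
      using that \<open>r > 0\<close> by (intro mult_mono) auto
    also have "\<dots> = e" using pos by (simp add: r_def)
    finally show ?thesis using e(2) by (auto simp: dist_norm subset_iff)
  qed
  have tilt: "exp ((\<theta> + s *\<^sub>R u) \<bullet> p) = exp (\<theta> \<bullet> p) * exp (s * (u \<bullet> p))" for s p
    by (simp add: inner_add_left exp_add)
  have fib: "{y\<in>Y. u \<bullet> f y = u \<bullet> d} = {y\<in>Y. f y = d}"
            "{y\<in>Y'. u \<bullet> g y = u \<bullet> d} = {y\<in>Y'. g y = d}"
    using u by (force simp: inner_diff_right)+
  have "(\<Sum>\<^sub>\<infinity>y\<in>{y\<in>Y. u \<bullet> f y = u \<bullet> d}. exp (\<theta> \<bullet> f y))
      = (\<Sum>\<^sub>\<infinity>y\<in>{y\<in>Y'. u \<bullet> g y = u \<bullet> d}. exp (\<theta> \<bullet> g y))"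
    by (rule exponential_sums_determine_atoms[OF \<open>r > 0\<close>])
       (use summ[OF mem] eq[OF mem] in \<open>simp_all add: tilt\<close>)
  moreover have "(\<Sum>\<^sub>\<infinity>y\<in>{y\<in>Y. f y = d}. exp (\<theta> \<bullet> f y)) = card {y\<in>Y. f y = d} * exp (\<theta> \<bullet> d)"
    using finite_fibre[OF summ(1)[OF \<theta>]] by simp
  moreover have "(\<Sum>\<^sub>\<infinity>y\<in>{y\<in>Y'. g y = d}. exp (\<theta> \<bullet> g y)) = card {y\<in>Y'. g y = d} * exp (\<theta> \<bullet> d)"
    using finite_fibre[OF summ(2)[OF \<theta>]] by simp
  ultimately show ?thesis by (simp add: fib)
qed

text \<open>
  Finite fibres of equal size are matched one by one, and the matchings are glued together.
\<close>

lemma bij_betw_of_equal_multiplicities: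
  assumes "\<And>d. finite {y\<in>Y. f y = d}" "\<And>d. finite {y\<in>Y'. g y = d}"
    and "\<And>d. card {y\<in>Y. f y = d} = card {y\<in>Y'. g y = d}"
  obtains h where "bij_betw h Y Y'" "\<And>y. y \<in> Y \<Longrightarrow> g (h y) = f y"
proof -
  have "\<exists>h. bij_betw h {y\<in>Y. f y = d} {y\<in>Y'. g y = d}" for d
    using assms by (intro finite_same_card_bij) auto
  then obtain h where h: "\<And>d. bij_betw (h d) {y\<in>Y. f y = d} {y\<in>Y'. g y = d}"
    by metis
  define k where "k y = h (f y) y" for y
  have g: "k y \<in> Y'" "g (k y) = f y" if "y \<in> Y" for y
    using bij_betwE[OF h[of "f y"]] that by (auto simp: k_def)
  have "inj_on k Y"
  proof (rule inj_onI)
    fix x y assume xy: "x \<in> Y" "y \<in> Y" "k x = k y"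
    then have "f x = f y" using g by metis
    with xy show "x = y"
      using bij_betw_imp_inj_on[OF h[of "f y"]] by (auto simp: k_def inj_on_def)
  qed
  moreover have "y \<in> k ` Y" if "y \<in> Y'" for y
  proof -
    have "y \<in> h (g y) ` {x\<in>Y. f x = g y}"
      using bij_betw_imp_surj_on[OF h[of "g y"]] that by auto
    then obtain x where "x \<in> Y" "f x = g y" "y = h (g y) x" by blast
    then have "k x = y" by (simp add: k_def)
    with \<open>x \<in> Y\<close> show ?thesis by blast
  qed
  ultimately have "bij_betw k Y Y'"
    using g by (auto simp: bij_betw_def)
  with g that show thesis by blast
qed


section \<open>Marginals of an exponential family\<close>

lemma partition_fun_pos:
  assumes "X A \<noteq> {}" "(\<lambda>x. exp (\<theta> \<bullet> t A x)) summable_on X A"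
  shows "partition_fun X t A \<theta> > 0"
proof (rule ccontr)
  assume "\<not> ?thesis"
  then have "(\<Sum>\<^sub>\<infinity>x\<in>X A. exp (\<theta> \<bullet> t A x)) \<le> 0"
    by (simp add: partition_fun_def)
  then have "exp (\<theta> \<bullet> t A x) = 0" if "x \<in> X A" for x
    using nonneg_infsum_le_0D[OF _ assms(2) _ that] by simp
  then show False using assms(1) by auto
qed

lemma expfam_mass_summable:
  assumes "(\<lambda>x. exp (\<theta> \<bullet> t A x)) summable_on X A"
  shows "expfam_mass X t A \<theta> summable_on X A"
  using assms unfolding expfam_mass_def divide_inverse by (rule summable_on_cmult_left)

lemma expfam_mass_nonneg: "expfam_mass X t A \<theta> x \<ge> 0"
  by (auto simp: expfam_mass_def partition_fun_def intro!: divide_nonneg_nonneg infsum_nonneg)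

lemma coord_proj_fibre:
  assumes "bij_betw (pair A B) (X A \<times> X (B - A)) (X B)" and "x \<in> X A"
  shows "coord_proj X pair B A -` {x} \<inter> X B = (\<lambda>y. pair A B (x, y)) ` X (B - A)"
proof -
  have "X B = pair A B ` (X A \<times> X (B - A))"
    using assms(1) by (simp add: bij_betw_def)
  moreover have "coord_proj X pair B A (pair A B p) = fst p" if "p \<in> X A \<times> X (B - A)" for p
    using assms(1) that by (auto simp: coord_proj_def bij_betw_def inv_into_f_f)
  ultimately show ?thesis
    using assms(2) by (auto simp: image_iff)
qed

text \<open>
  Measures on a countable set are determined by their point masses, and the projected distribution
  gives to \<open>{x}\<close> the total mass of the fibre over \<open>x\<close>.
\<close>

lemma distr_eq_iff_marginal_masses:
  assumes bij: "bij_betw (pair A B) (X A \<times> X (B - A)) (X B)"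
    and "countable (X A)"
    and summ: "(\<lambda>x. exp (\<theta> \<bullet> t A x)) summable_on X A" "(\<lambda>x. exp (\<theta> \<bullet> t B x)) summable_on X B"
  shows "expfam_distr X t A \<theta> =
           distr (expfam_distr X t B \<theta>) (count_space (X A)) (coord_proj X pair B A) \<longleftrightarrow>
         (\<forall>x\<in>X A. expfam_mass X t A \<theta> x =
           (\<Sum>\<^sub>\<infinity>y\<in>X (B - A). expfam_mass X t B \<theta> (pair A B (x, y))))"
    (is "?P = ?Q \<longleftrightarrow> (\<forall>x\<in>X A. ?p x = ?q x)")
proof -
  have proj: "coord_proj X pair B A \<in> X B \<rightarrow> X A"
  proof
    fix z assume "z \<in> X B"
    then have "inv_into (X A \<times> X (B - A)) (pair A B) z \<in> X A \<times> X (B - A)"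
      using bij by (intro inv_into_into) (simp add: bij_betw_def)
    then show "coord_proj X pair B A z \<in> X A"
      unfolding coord_proj_def mem_Times_iff by blast
  qed
  have P: "emeasure ?P {x} = ennreal (?p x)" if "x \<in> X A" for x
    using that expfam_mass_nonneg[of X t A \<theta>] expfam_mass_summable[of \<theta> t A X] summ(1)
    by (simp add: expfam_distr_def emeasure_point_measure_infsum)
  have Q: "emeasure ?Q {x} = ennreal (?q x)" if "x \<in> X A" for x
  proof -
    have sub: "(\<lambda>y. pair A B (x, y)) ` X (B - A) \<subseteq> X B"
      using bij that by (auto simp: bij_betw_def)
    have inj: "inj_on (\<lambda>y. pair A B (x, y)) (X (B - A))"
      using bij that by (auto simp: bij_betw_def inj_on_def)
    have "emeasure ?Q {x} = emeasure (expfam_distr X t B \<theta>) ((\<lambda>y. pair A B (x, y)) ` X (B - A))"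
      using that proj coord_proj_fibre[of pair A B X x] bij
      by (subst emeasure_distr) (auto simp: expfam_distr_def space_point_measure point_measure_def)
    also have "\<dots> = ennreal (\<Sum>\<^sub>\<infinity>z\<in>(\<lambda>y. pair A B (x, y)) ` X (B - A). expfam_mass X t B \<theta> z)"
      unfolding expfam_distr_def
      by (intro emeasure_point_measure_infsum sub expfam_mass_summable summ expfam_mass_nonneg)
    also have "\<dots> = ennreal (?q x)"
      by (simp add: infsum_reindex[OF inj] o_def)
    finally show ?thesis .
  qed
  have "?P = ?Q \<longleftrightarrow> (\<forall>x\<in>X A. emeasure ?P {x} = emeasure ?Q {x})"
  proof
    assume "\<forall>x\<in>X A. emeasure ?P {x} = emeasure ?Q {x}"
    then show "?P = ?Q"
      using assms(2) by (intro measure_eqI_countable[of _ "X A"])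
        (auto simp: expfam_distr_def sets_point_measure)
  qed simp
  also have "\<dots> \<longleftrightarrow> (\<forall>x\<in>X A. ?p x = ?q x)"
    by (intro ball_cong refl)
       (simp add: P Q ennreal_inj expfam_mass_nonneg infsum_nonneg)
  finally show ?thesis .
qed

text \<open>
  Up to the factor \<open>exp (\<theta> \<bullet> t A x)\<close>, this series is the part of the partition function of \<open>B\<close> that
  belongs to the fibre over \<open>x\<close>.
\<close>

lemma exp_increment_summable:
  assumes "bij_betw (pair A B) (X A \<times> X (B - A)) (X B)"
    and "(\<lambda>x. exp (\<theta> \<bullet> t B x)) summable_on X B" and "x \<in> X A"
  shows "(\<lambda>y. exp (\<theta> \<bullet> increment pair t A B x y)) summable_on X (B - A)"
proof -
  have "(\<lambda>p. exp (\<theta> \<bullet> t B (pair A B p))) summable_on X A \<times> X (B - A)"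
    using assms(1,2) by (simp add: summable_on_reindex_bij_betw[OF assms(1), of "\<lambda>z. exp (\<theta> \<bullet> t B z)"])
  then have "(\<lambda>p. exp (\<theta> \<bullet> t B (pair A B p))) summable_on Pair x ` X (B - A)"
    by (rule summable_on_subset_banach) (use assms(3) in auto)
  then have "(\<lambda>y. exp (\<theta> \<bullet> t B (pair A B (x, y)))) summable_on X (B - A)"
    by (subst (asm) summable_on_reindex) (auto simp: inj_on_def o_def)
  then have "(\<lambda>y. exp (\<theta> \<bullet> t B (pair A B (x, y))) * exp (- (\<theta> \<bullet> t A x))) summable_on X (B - A)"
    by (rule summable_on_cmult_left)
  then show ?thesis
    by (simp add: increment_def inner_diff_right exp_diff exp_minus divide_inverse)
qed

text \<open>
  The marginal masses are \<open>exp (\<theta> \<bullet> t A x)\<close> times the increment sum, divided by the partition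
  function of \<open>B\<close>.  They are right exactly when each increment sum equals the quotient of the two
  partition functions.  If the increment sum does not depend on \<open>x\<close>, summing over \<open>x\<close> shows that
  its value can only be this quotient.
\<close>

lemma marginal_masses_iff_constant_increment_sum:
  assumes bij: "bij_betw (pair A B) (X A \<times> X (B - A)) (X B)"
    and ne: "X A \<noteq> {}" "X B \<noteq> {}"
    and summ: "(\<lambda>x. exp (\<theta> \<bullet> t A x)) summable_on X A" "(\<lambda>x. exp (\<theta> \<bullet> t B x)) summable_on X B"
  shows "(\<forall>x\<in>X A. expfam_mass X t A \<theta> x =
           (\<Sum>\<^sub>\<infinity>y\<in>X (B - A). expfam_mass X t B \<theta> (pair A B (x, y)))) \<longleftrightarrow>
         (\<forall>x\<in>X A. \<forall>x'\<in>X A. (\<Sum>\<^sub>\<infinity>y\<in>X (B - A). exp (\<theta> \<bullet> increment pair t A B x y)) =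
                              (\<Sum>\<^sub>\<infinity>y\<in>X (B - A). exp (\<theta> \<bullet> increment pair t A B x' y)))"
    (is "?lhs \<longleftrightarrow> _")
proof -
  let ?L = "\<lambda>x. \<Sum>\<^sub>\<infinity>y\<in>X (B - A). exp (\<theta> \<bullet> increment pair t A B x y)"
  let ?zA = "partition_fun X t A \<theta>" and ?zB = "partition_fun X t B \<theta>"
  have z: "?zA > 0" "?zB > 0"
    by (rule partition_fun_pos[of X A \<theta> t, OF ne(1) summ(1)],
        rule partition_fun_pos[of X B \<theta> t, OF ne(2) summ(2)])
  have split: "exp (\<theta> \<bullet> t B (pair A B (x, y)))
      = exp (\<theta> \<bullet> t A x) * exp (\<theta> \<bullet> increment pair t A B x y)" for x y
    by (simp add: increment_def inner_diff_right exp_diff)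
  have marginal: "(\<Sum>\<^sub>\<infinity>y\<in>X (B - A). expfam_mass X t B \<theta> (pair A B (x, y)))
      = exp (\<theta> \<bullet> t A x) * ?L x / ?zB" for x
    unfolding expfam_mass_def split divide_inverse infsum_cmult_left' infsum_cmult_right' ..
  have lhs: "?lhs \<longleftrightarrow> (\<forall>x\<in>X A. ?zA * ?L x = ?zB)"
    unfolding marginal
  proof (intro ball_cong refl)
    fix x
    have "exp (\<theta> \<bullet> t A x) / ?zA = exp (\<theta> \<bullet> t A x) * ?L x / ?zB \<longleftrightarrow>
        exp (\<theta> \<bullet> t A x) * ?zB = exp (\<theta> \<bullet> t A x) * (?zA * ?L x)"
      using z by (simp only: frac_eq_eq) (simp add: mult_ac)
    also have "\<dots> \<longleftrightarrow> ?zA * ?L x = ?zB"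
      by auto
    finally show "expfam_mass X t A \<theta> x = exp (\<theta> \<bullet> t A x) * ?L x / ?zB \<longleftrightarrow> ?zA * ?L x = ?zB"
      by (simp only: expfam_mass_def)
  qed
  have total: "?zB = (\<Sum>\<^sub>\<infinity>x\<in>X A. exp (\<theta> \<bullet> t A x) * ?L x)"
  proof -
    have "(\<lambda>p. exp (\<theta> \<bullet> t B (pair A B p))) summable_on X A \<times> X (B - A)"
      using summ(2) by (simp add: summable_on_reindex_bij_betw[OF bij, of "\<lambda>z. exp (\<theta> \<bullet> t B z)"])
    from infsum_Sigma_banach[OF this] show ?thesis
      unfolding partition_fun_def split infsum_cmult_right'
        infsum_reindex_bij_betw[OF bij, of "\<lambda>z. exp (\<theta> \<bullet> t B z)"] by (rule sym)
  qed
  show ?thesis unfolding lhs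
  proof safe
    fix x x' assume "\<forall>x\<in>X A. ?zA * ?L x = ?zB" "x \<in> X A" "x' \<in> X A"
    then have "?zA * ?L x = ?zA * ?L x'" by simp
    then show "?L x = ?L x'" using z by simp
  next
    fix x assume const: "\<forall>x\<in>X A. \<forall>x'\<in>X A. ?L x = ?L x'" and x: "x \<in> X A"
    have "?zB = (\<Sum>\<^sub>\<infinity>x'\<in>X A. exp (\<theta> \<bullet> t A x') * ?L x)"
      unfolding total using const x by (intro infsum_cong) metis
    then show "?zA * ?L x = ?zB"
      by (simp add: infsum_cmult_left' partition_fun_def)
  qed
qed

section \<open>Projectivity and separable increments\<close>

theorem theorem1:
  fixes I :: "'i set"
    and \<A> :: "'i set set"
    and X :: "'i set \<Rightarrow> 'x set"
    and pair :: "'i set \<Rightarrow> 'i set \<Rightarrow> 'x \<times> 'x \<Rightarrow> 'x"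
    and \<Theta> :: "(real ^ 'd) set"
    and t :: "'i set \<Rightarrow> 'x \<Rightarrow> real ^ 'd"
  assumes "countable I" and "infinite I"
    and "ideal_of_finite_sets I \<A>"
    and "\<And>A. A \<in> \<A> \<Longrightarrow> countable (X A)"
    and "\<And>A. A \<in> \<A> \<Longrightarrow> X A \<noteq> {}"
    and "product_spaces \<A> X pair"
    and "open \<Theta>" and "\<Theta> \<noteq> {}"
    and "\<And>A \<theta>. A \<in> \<A> \<Longrightarrow> \<theta> \<in> \<Theta> \<Longrightarrow> (\<lambda>x. exp (\<theta> \<bullet> t A x)) summable_on X A"
  shows "projective_exp_family \<A> X pair \<Theta> t \<longleftrightarrow> separable_increments \<A> X pair t"
proof -
  have main: "(\<forall>\<theta>\<in>\<Theta>. expfam_distr X t A \<theta> =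
                 distr (expfam_distr X t B \<theta>) (count_space (X A)) (coord_proj X pair B A)) \<longleftrightarrow>
      (\<forall>x\<in>X A. \<forall>x'\<in>X A.
         increment pair t A B x ` X (B - A) = increment pair t A B x' ` X (B - A)) \<and>
      (\<exists>v. \<forall>x\<in>X A. \<forall>\<delta>. cond_volume X pair t A B \<delta> x = v \<delta>)"
    (is "?proj \<longleftrightarrow> ?range \<and> ?vol")
    if A: "A \<in> \<A>" and B: "B \<in> \<A>" and AB: "A \<subset> B" for A B
  proof -
    let ?L = "\<lambda>\<theta> x. \<Sum>\<^sub>\<infinity>y\<in>X (B - A). exp (\<theta> \<bullet> increment pair t A B x y)"
    let ?N = "\<lambda>x \<delta>. {y \<in> X (B - A). increment pair t A B x y = \<delta>}"
    have bij: "bij_betw (pair A B) (X A \<times> X (B - A)) (X B)"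
      using assms(6) A B AB by (auto simp: product_spaces_def)
    have "B - A \<in> \<A>"
      using assms(3) B by (auto simp: ideal_of_finite_sets_def)
    then have countable: "countable (X (B - A))" by (rule assms(4))
    have summable: "(\<lambda>y. exp (\<theta> \<bullet> increment pair t A B x y)) summable_on X (B - A)"
      if "\<theta> \<in> \<Theta>" "x \<in> X A" for \<theta> x
      using bij assms(9)[OF B that(1)] that(2) by (rule exp_increment_summable)
    have finite: "finite (?N x \<delta>)" if "x \<in> X A" for x \<delta>
      using assms(8) summable[OF _ that] finite_fibre by blast
    have proj: "?proj \<longleftrightarrow> (\<forall>\<theta>\<in>\<Theta>. \<forall>x\<in>X A. \<forall>x'\<in>X A. ?L \<theta> x = ?L \<theta> x')"
      using assms(4,5,9) A B bij
      by (intro ball_cong refl) (simp add: distr_eq_iff_marginal_masses[of pair A B X _ t]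
          marginal_masses_iff_constant_increment_sum[of pair A B X _ t])
    show ?thesis unfolding proj
    proof (intro iffI conjI)
      assume L: "\<forall>\<theta>\<in>\<Theta>. \<forall>x\<in>X A. \<forall>x'\<in>X A. ?L \<theta> x = ?L \<theta> x'"
      have card: "card (?N x \<delta>) = card (?N x' \<delta>)" if "x \<in> X A" "x' \<in> X A" for x x' \<delta>
        using exponential_sums_determine_multiplicities[OF countable countable assms(7,8)
            summable[OF _ that(1)] summable[OF _ that(2)]] L that by blast
      have range: "increment pair t A B x ` X (B - A) = {\<delta>. card (?N x \<delta>) \<noteq> 0}" if "x \<in> X A" for x
        using finite[OF that] by (auto simp: card_eq_0_iff)
      show ?range
      proof (intro ballI)
        fix x x' assume x: "x \<in> X A" "x' \<in> X A"
        show "increment pair t A B x ` X (B - A) = increment pair t A B x' ` X (B - A)"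
          unfolding range[OF x(1)] range[OF x(2)] card[OF x] ..
      qed
      obtain x where x: "x \<in> X A" using assms(5)[OF A] by blast
      have "\<forall>x'\<in>X A. \<forall>\<delta>. cond_volume X pair t A B \<delta> x' = card (?N x \<delta>)"
        unfolding cond_volume_def using card[OF _ x] by blast
      then show ?vol by (rule exI[of _ "\<lambda>\<delta>. card (?N x \<delta>)"])
    next
      assume "?range \<and> ?vol"
      then have card: "card (?N x \<delta>) = card (?N x' \<delta>)" if "x \<in> X A" "x' \<in> X A" for x x' \<delta>
        using that by (auto simp: cond_volume_def)
      show "\<forall>\<theta>\<in>\<Theta>. \<forall>x\<in>X A. \<forall>x'\<in>X A. ?L \<theta> x = ?L \<theta> x'"
      proof (intro ballI)
        fix \<theta> x x' assume x: "x \<in> X A" "x' \<in> X A"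
        obtain h where "bij_betw h (X (B - A)) (X (B - A))"
          and "\<And>y. y \<in> X (B - A) \<Longrightarrow> increment pair t A B x' (h y) = increment pair t A B x y"
          using bij_betw_of_equal_multiplicities[OF finite[OF x(1)] finite[OF x(2)] card[OF x]]
          by blast
        then show "?L \<theta> x = ?L \<theta> x'"
          using infsum_reindex_bij_betw[of h "X (B - A)" "X (B - A)"
              "\<lambda>y. exp (\<theta> \<bullet> increment pair t A B x' y)"]
          by (simp cong: infsum_cong)
      qed
    qed
  qed
  show ?thesis
    unfolding projective_exp_family_def separable_increments_def
    by (intro ball_cong imp_cong refl main)
qed

end
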